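(* There exist a compact set $K \subset \mathbb{R}$ and a map $\Gamma=(f,g,h) \in \mathfrak{C}^1(K,\mathbb{R}^3)$ with Whitney derivative $\Gamma'=(f',g',h')$ satisfying $h'=2 (f' g - f g')$ on $K$ such that no $C^1$ horizontal curve $\tilde{\Gamma}: \mathbb{R} \to \mathbb{H}^1$ satisfies $\tilde{\Gamma}|_K = \Gamma$.
   Context: Whitney class: for $K \subset \mathbb{R}$ compact, a continuous map $\Gamma : K \to \mathbb{R}^{N}$ is of Whitney class $\mathfrak{C}^1(K,\mathbb{R}^{N})$ with Whitney derivative $\Gamma'$ if $\Gamma' : K \to \mathbb{R}^N$ is a continuous map with $$\lim_{\substack{|b-a| \to 0 \\ a,b \in K}} \frac{|\Gamma(b)-\Gamma(a)-(b-a)\Gamma'(a)|}{|b-a|} = 0,$$ the limit being uniform (for every $\varepsilon>0$ there is $\delta>0$ such that the quotient is less than $\varepsilon$ for all $a,b\in K$ with $0<|b-a|<\delta$). The first Heisenberg group $\mathbb{H}^1$ is $\mathbb{R}^3$ with coordinates $(x,y,t)$ and horizontal distribution spanned by $X=\partial_x+2y\partial_t$ and $Y=\partial_y-2x\partial_t$. A $C^1$ curve $\tilde\Gamma=(\tilde f,\tilde g,\tilde h):\mathbb{R}\to\mathbb{R}^3$ ($C^1$ in the usual Euclidean sense) is horizontal if $\tilde\Gamma'(s)$ lies in the horizontal space at $\tilde\Gamma(s)$ for every $s$, equivalently $\tilde h'=2(\tilde f'\tilde g-\tilde f\tilde g')$ on $\mathbb{R}$. *)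

theory Defs
  imports "HOL-Analysis.Analysis"
begin

text \<open>
  The Whitney derivative is a parameter because it is part of the data: it is not determined by
  \<open>\<Gamma>\<close> at isolated points of \<open>K\<close>. Values of both functions outside \<open>K\<close> are irrelevant.
\<close>

definition whitney_C1 :: "real set \<Rightarrow> (real \<Rightarrow> real ^ 'n) \<Rightarrow> (real \<Rightarrow> real ^ 'n) \<Rightarrow> bool" where
  "whitney_C1 K \<Gamma> \<Gamma>' \<longleftrightarrow>
     continuous_on K \<Gamma> \<and> continuous_on K \<Gamma>' \<and>
     (\<forall>\<epsilon>>0. \<exists>\<delta>>0. \<forall>a\<in>K. \<forall>b\<in>K. 0 < \<bar>b - a\<bar> \<and> \<bar>b - a\<bar> < \<delta> \<longrightarrow>
        norm (\<Gamma> b - \<Gamma> a - (b - a) *\<^sub>R \<Gamma>' a) / \<bar>b - a\<bar> < \<epsilon>)"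

text \<open>
  The first Heisenberg group is \<open>real ^ 3\<close> with coordinates \<open>(x, y, t) = (p $ 1, p $ 2, p $ 3)\<close>.
  The vector fields \<open>X = \<partial>\<^sub>x + 2 y \<partial>\<^sub>t\<close> and \<open>Y = \<partial>\<^sub>y - 2 x \<partial>\<^sub>t\<close> are given by their coefficient vectors.
\<close>

definition heis_X :: "real ^ 3 \<Rightarrow> real ^ 3" where
  "heis_X p = vector [1, 0, 2 * p $ 2]"

definition heis_Y :: "real ^ 3 \<Rightarrow> real ^ 3" where
  "heis_Y p = vector [0, 1, - 2 * p $ 1]"

definition horizontal_space :: "real ^ 3 \<Rightarrow> (real ^ 3) set" where
  "horizontal_space p = span {heis_X p, heis_Y p}"

definition C1_horizontal_curve :: "(real \<Rightarrow> real ^ 3) \<Rightarrow> bool" where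
  "C1_horizontal_curve \<gamma> \<longleftrightarrow>
     \<gamma> C1_differentiable_on UNIV \<and>
     (\<forall>s. vector_derivative \<gamma> (at s) \<in> horizontal_space (\<gamma> s))"

lemma mem_horizontal_space_iff:
  "v \<in> horizontal_space p \<longleftrightarrow> v $ 3 = 2 * (v $ 1 * p $ 2 - p $ 1 * v $ 2)"
proof -
  have "v \<in> horizontal_space p \<longleftrightarrow> (\<exists>a b. v = a *\<^sub>R heis_X p + b *\<^sub>R heis_Y p)"
    unfolding horizontal_space_def span_insert span_singleton
    by (simp add: algebra_simps) 
  also have "\<dots> \<longleftrightarrow> v $ 3 = 2 * (v $ 1 * p $ 2 - p $ 1 * v $ 2)"
    by (auto simp: vec_eq_iff forall_3 heis_X_def heis_Y_def algebra_simps)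
  finally show ?thesis .
qed

end

theory Submission
  imports Defs
begin

text \<open>
  A \<open>C\<^sup>1\<close> horizontal curve that starts on the vertical axis rises by only \<open>O((b - a)\<^sup>2)\<close> over an
  interval \<open>[a, b]\<close>: its planar part is \<open>O(b - a)\<close> there, hence so is its vertical speed. The Whitney
  condition, in contrast, allows every rise that is \<open>o(b - a)\<close>. Take \<open>K = {0} \<union> {1 / n}\<close>, where
  neighbouring points near \<open>s\<close> are about \<open>s\<^sup>2\<close> apart, and \<open>\<Gamma> s = (0, 0, s\<^sup>2)\<close> with Whitney derivative \<open>0\<close>:
  between neighbours the rise is about \<open>s\<^sup>3\<close>, which is \<open>o(s\<^sup>2)\<close> but not \<open>O(s\<^sup>4)\<close>.
\<close>

lemma horizontal_rise_le:
  fixes \<gamma> \<gamma>' :: "real \<Rightarrow> real ^ 3"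
  assumes "a < b"
    and deriv: "\<And>s. s \<in> {a..b} \<Longrightarrow> (\<gamma> has_vector_derivative \<gamma>' s) (at s)"
    and horiz: "\<And>s. s \<in> {a..b} \<Longrightarrow> \<gamma>' s \<in> horizontal_space (\<gamma> s)"
    and bound: "\<And>s. s \<in> {a..b} \<Longrightarrow> norm (\<gamma>' s) \<le> M"
    and start: "\<gamma> a $ 1 = 0" "\<gamma> a $ 2 = 0"
  shows "\<bar>\<gamma> b $ 3 - \<gamma> a $ 3\<bar> \<le> 4 * M\<^sup>2 * (b - a)\<^sup>2"
proof -
  have comp_deriv: "((\<lambda>s. \<gamma> s $ i) has_real_derivative \<gamma>' s $ i) (at s)" if "s \<in> {a..b}" for s i
    using bounded_linear.has_vector_derivative[OF bounded_linear_vec_nth deriv[OF that]]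
    by (simp add: has_real_derivative_iff_has_vector_derivative)
  have comp_bound: "\<bar>\<gamma>' s $ i\<bar> \<le> M" if "s \<in> {a..b}" for s i
    using component_le_norm_cart[of "\<gamma>' s" i] bound[OF that] by linarith
  have "0 \<le> M"
    using comp_bound[of a 1] \<open>a < b\<close> by simp
  have planar: "\<bar>\<gamma> s $ i\<bar> \<le> M * (b - a)" if s: "s \<in> {a..b}" and i: "\<gamma> a $ i = 0" for s i
  proof -
    have "norm (\<gamma> s $ i - \<gamma> a $ i) \<le> M * norm (s - a)"
    proof (rule field_differentiable_bound[of "{a..b}"])
      show "((\<lambda>s. \<gamma> s $ i) has_field_derivative \<gamma>' z $ i) (at z within {a..b})"
        if "z \<in> {a..b}" for z
        using comp_deriv[OF that] by (rule has_field_derivative_at_within)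
    qed (use comp_bound s \<open>a < b\<close> in auto)
    also have "\<dots> \<le> M * (b - a)"
      using s \<open>0 \<le> M\<close> by (intro mult_left_mono) auto
    finally show ?thesis
      using i by simp
  qed
  \<comment> \<open>The rise is one factor \<open>b - a\<close> times the vertical speed at an
    intermediate point; the second factor \<open>b - a\<close> will come from
    \<open>planar\<close>.\<close>
  obtain \<xi> where \<xi>: "a < \<xi>" "\<xi> < b" and mvt: "\<gamma> b $ 3 - \<gamma> a $ 3 = (b - a) * \<gamma>' \<xi> $ 3"
    using MVT2[of a b "\<lambda>s. \<gamma> s $ 3" "\<lambda>s. \<gamma>' s $ 3"] comp_deriv \<open>a < b\<close> by auto
  have \<xi>_mem: "\<xi> \<in> {a..b}"
    using \<xi> by simp
  have "\<bar>\<gamma>' \<xi> $ 1 * \<gamma> \<xi> $ 2\<bar> \<le> M * (M * (b - a))" "\<bar>\<gamma> \<xi> $ 1 * \<gamma>' \<xi> $ 2\<bar> \<le> M * (b - a) * M"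
    unfolding abs_mult using comp_bound[OF \<xi>_mem] planar[OF \<xi>_mem] start \<open>0 \<le> M\<close> \<open>a < b\<close>
    by (intro mult_mono; simp)+
  moreover have "\<gamma>' \<xi> $ 3 = 2 * (\<gamma>' \<xi> $ 1 * \<gamma> \<xi> $ 2 - \<gamma> \<xi> $ 1 * \<gamma>' \<xi> $ 2)"
    using horiz[OF \<xi>_mem] by (simp add: mem_horizontal_space_iff)
  \<comment> \<open>The constant 4 arises because horizontality doubles a difference of two
    products, each at most \<open>M\<^sup>2 * (b - a)\<close> in absolute value.\<close>
  ultimately have "\<bar>\<gamma>' \<xi> $ 3\<bar> \<le> 4 * M\<^sup>2 * (b - a)"
    by (simp add: power2_eq_square algebra_simps)
  then have "(b - a) * \<bar>\<gamma>' \<xi> $ 3\<bar> \<le> (b - a) * (4 * M\<^sup>2 * (b - a))"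
    using \<open>a < b\<close> by (intro mult_left_mono) auto
  then show ?thesis
    using \<open>a < b\<close> by (simp add: mvt abs_mult power2_eq_square mult_ac)
qed

definition harmonic_points :: "real set" where
  "harmonic_points = insert 0 (range (\<lambda>n. inverse (real (Suc n))))"

lemma compact_harmonic_points: "compact harmonic_points"
  unfolding harmonic_points_def
  using LIMSEQ_inverse_real_of_nat by (rule compact_sequence_with_limit)

lemma harmonic_points_nonneg: "a \<in> harmonic_points \<Longrightarrow> 0 \<le> a"
  by (auto simp: harmonic_points_def)

text \<open>The nearest point below \<open>b\<close> is its successor \<open>c\<close> in the
  sequence, and \<open>b - c = b * c\<close> with \<open>c\<close> at least \<open>b / 2\<close>.
  Thus points of the set that are close together are also close to 0.\<close>

lemma harmonic_points_gap:
  assumes "a \<in> harmonic_points" "b \<in> harmonic_points" "a < b"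
  shows "b\<^sup>2 \<le> 2 * (b - a)"
proof -
  obtain n where n: "b = inverse (real (Suc n))"
    using assms harmonic_points_nonneg[of a] by (auto simp: harmonic_points_def)
  define c where "c = inverse (real (Suc (Suc n)))"
  have "a \<le> c"
  proof (cases "a = 0")
    case False
    then obtain m where m: "a = inverse (real (Suc m))"
      using assms by (auto simp: harmonic_points_def)
    with n \<open>a < b\<close> have "n < m"
      by (simp add: inverse_less_iff_less)
    with m show ?thesis
      by (simp add: c_def inverse_le_iff_le)
  qed (simp add: c_def)
  have "b\<^sup>2 \<le> 2 * (b - c)"
  proof -
    have "b * b \<le> b * (2 * c)"
      unfolding n c_def by (intro mult_left_mono) (simp_all add: field_simps)
    also have "\<dots> = 2 * (b - c)"
      unfolding n c_def by (simp add: field_simps)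
    finally show ?thesis
      by (simp add: power2_eq_square)
  qed
  also have "\<dots> \<le> 2 * (b - a)"
    using \<open>a \<le> c\<close> by simp
  finally show ?thesis .
qed

text \<open>The difference quotient of the square is \<open>a + b\<close>, which is small because
  two close points of the set are both near 0. Hence the Whitney derivative can vanish although
  \<open>s\<^sup>2\<close> has derivative \<open>2 * s\<close>.\<close>

lemma whitney_C1_harmonic_points:
  "whitney_C1 harmonic_points (\<lambda>s. axis 3 (s\<^sup>2) :: real ^ 3) (\<lambda>_. 0)"
proof -
  \<comment> \<open>The choice of \<open>\<epsilon>\<^sup>2 / 8\<close> comes from the gap estimate:
    \<open>(2 * b)\<^sup>2\<close> is at most \<open>8 * (b - a)\<close>, and
    \<open>a + b < 2 * b\<close>.\<close>
  have secant: "\<bar>b\<^sup>2 - a\<^sup>2\<bar> / \<bar>b - a\<bar> < \<epsilon>"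
    if ab: "a \<in> harmonic_points" "b \<in> harmonic_points" "a < b" and small: "b - a < \<epsilon>\<^sup>2 / 8"
      and "0 < \<epsilon>" for a b \<epsilon> :: real
  proof -
    have "0 \<le> a"
      using ab harmonic_points_nonneg by blast
    have "(2 * b)\<^sup>2 < \<epsilon>\<^sup>2"
      using harmonic_points_gap[OF ab] small by (simp add: power_mult_distrib)
    then have "2 * b < \<epsilon>"
      using \<open>0 < \<epsilon>\<close> by (intro power2_less_imp_less[of "2 * b"]) auto
    then have "a + b < \<epsilon>"
      using ab by linarith
    moreover have "b\<^sup>2 - a\<^sup>2 = (a + b) * (b - a)"
      by (simp add: power2_eq_square algebra_simps)
    ultimately show ?thesis
      using ab \<open>0 \<le> a\<close> by (simp add: abs_mult)
  qed
  have "\<exists>\<delta>>0. \<forall>a\<in>harmonic_points. \<forall>b\<in>harmonic_points. 0 < \<bar>b - a\<bar> \<and> \<bar>b - a\<bar> < \<delta> \<longrightarrow>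
      \<bar>b\<^sup>2 - a\<^sup>2\<bar> / \<bar>b - a\<bar> < \<epsilon>" if "0 < \<epsilon>" for \<epsilon> :: real
  proof (intro exI[of _ "\<epsilon>\<^sup>2 / 8"] conjI ballI impI)
    fix a b assume *: "a \<in> harmonic_points" "b \<in> harmonic_points"
      "0 < \<bar>b - a\<bar> \<and> \<bar>b - a\<bar> < \<epsilon>\<^sup>2 / 8"
    show "\<bar>b\<^sup>2 - a\<^sup>2\<bar> / \<bar>b - a\<bar> < \<epsilon>"
    proof (cases "a < b")
      case True
      with * that show ?thesis
        by (intro secant) auto
    next
      case False
      \<comment> \<open>With zero Whitney derivative the quotient is symmetric, so the two points
        may be exchanged.\<close>
      with * that have "\<bar>a\<^sup>2 - b\<^sup>2\<bar> / \<bar>a - b\<bar> < \<epsilon>"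
        by (intro secant) auto
      then show ?thesis
        by (simp add: abs_minus_commute)
    qed
  qed (use that in auto)
  moreover have "norm (axis 3 (b\<^sup>2) - axis 3 (a\<^sup>2) - (b - a) *\<^sub>R 0 :: real ^ 3) = \<bar>b\<^sup>2 - a\<^sup>2\<bar>"
    for a b :: real
  proof -
    have "axis 3 (b\<^sup>2) - axis 3 (a\<^sup>2) = (axis 3 (b\<^sup>2 - a\<^sup>2) :: real ^ 3)"
      by (simp add: vec_eq_iff axis_def)
    then show ?thesis
      by (simp add: norm_eq_sqrt_inner inner_axis_axis)
  qed
  moreover have "continuous_on harmonic_points (\<lambda>s. axis 3 (s\<^sup>2) :: real ^ 3)"
    unfolding axis_def
  proof (rule continuous_on_vec_lambda)
    show "continuous_on harmonic_points (\<lambda>s. if i = 3 then s\<^sup>2 else 0)" for i :: 3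
      by (cases "i = 3") (auto intro!: continuous_intros)
  qed
  ultimately show ?thesis
    by (simp add: whitney_C1_def)
qed

text \<open>By compactness one bound \<open>M\<close> on the speed serves all neighbouring pairs
  \<open>a < b\<close>. Their rise is \<open>(a + b) * (a * b)\<close>, whereas
  \<open>horizontal_rise_le\<close> allows only \<open>4 * M\<^sup>2 * (a * b)\<^sup>2\<close>,
  which is too little near 0.\<close>

lemma no_horizontal_extension:
  assumes "C1_horizontal_curve \<gamma>"
  shows "\<exists>s\<in>harmonic_points. \<gamma> s \<noteq> axis 3 (s\<^sup>2)"
proof (rule ccontr)
  assume "\<not> ?thesis"
  then have ext: "\<gamma> s = axis 3 (s\<^sup>2)" if "s \<in> harmonic_points" for s
    using that by blast
  obtain \<gamma>' where deriv: "\<And>s. (\<gamma> has_vector_derivative \<gamma>' s) (at s)"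
    and cont: "continuous_on UNIV \<gamma>'"
    using assms by (auto simp: C1_horizontal_curve_def C1_differentiable_on_def)
  have horiz: "\<gamma>' s \<in> horizontal_space (\<gamma> s)" for s
    using assms vector_derivative_at[OF deriv] by (simp add: C1_horizontal_curve_def)
  have "bounded (\<gamma>' ` {0..1})"
    using cont by (intro compact_imp_bounded compact_continuous_image)
      (auto intro: continuous_on_subset)
  then obtain M where M: "\<And>s. s \<in> {0..1} \<Longrightarrow> norm (\<gamma>' s) \<le> M"
    by (fastforce simp: bounded_iff)
  \<comment> \<open>The estimates below end in \<open>1 \<le> 4 * M\<^sup>2 * a\<close> with
    \<open>a = 1 / (n + 2)\<close>, which this choice of \<open>n\<close> excludes.\<close>
  obtain n where n: "4 * M\<^sup>2 < real n"
    using reals_Archimedean2 by blast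
  define a b where "a = inverse (real (Suc (Suc n)))" and "b = inverse (real (Suc n))"
  have mem: "a \<in> harmonic_points" "b \<in> harmonic_points"
    unfolding a_def b_def harmonic_points_def by blast+
  have ab: "0 < a" "a < b" "b \<le> 1" and gap: "b - a = a * b"
    by (simp_all add: a_def b_def field_simps)
  have "\<bar>\<gamma> b $ 3 - \<gamma> a $ 3\<bar> \<le> 4 * M\<^sup>2 * (b - a)\<^sup>2"
    using ab mem by (intro horizontal_rise_le[where \<gamma>' = \<gamma>'] deriv horiz M) (auto simp: ext axis_def)
  then have "b\<^sup>2 - a\<^sup>2 \<le> 4 * M\<^sup>2 * (b - a)\<^sup>2"
    using mem by (simp add: ext axis_def)
  then have "(b + a) * (b - a) \<le> 4 * M\<^sup>2 * (a * b) * (b - a)"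
    by (simp add: gap[symmetric] power2_eq_square algebra_simps)
  then have "b + a \<le> 4 * M\<^sup>2 * (a * b)"
    using ab by simp
  moreover have "4 * M\<^sup>2 * (a * b) = b * (4 * M\<^sup>2 * a)"
    by simp
  \<comment> \<open>Dropping the positive summand \<open>a\<close> on the left lets \<open>b\<close>
    cancel.\<close>
  ultimately have "b * 1 \<le> b * (4 * M\<^sup>2 * a)"
    using ab by linarith
  then have "1 \<le> 4 * M\<^sup>2 * a"
    using ab mult_le_cancel_left_pos[of b] by simp
  then have "real (Suc (Suc n)) \<le> 4 * M\<^sup>2"
    by (simp add: a_def field_simps)
  with n show False
    by simp
qed

theorem proposition1p3:
  shows "\<exists>(K :: real set) (\<Gamma> :: real \<Rightarrow> real ^ 3) (\<Gamma>' :: real \<Rightarrow> real ^ 3).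
    compact K \<and> whitney_C1 K \<Gamma> \<Gamma>' \<and>
    (\<forall>s\<in>K. \<Gamma>' s $ 3 = 2 * (\<Gamma>' s $ 1 * \<Gamma> s $ 2 - \<Gamma> s $ 1 * \<Gamma>' s $ 2)) \<and>
    \<not> (\<exists>\<gamma>. C1_horizontal_curve \<gamma> \<and> (\<forall>s\<in>K. \<gamma> s = \<Gamma> s))"
proof (intro exI conjI)
  show "compact harmonic_points"
    by (fact compact_harmonic_points)
  show "whitney_C1 harmonic_points (\<lambda>s. axis 3 (s\<^sup>2) :: real ^ 3) (\<lambda>_. 0)"
    by (fact whitney_C1_harmonic_points)
\<comment> \<open>The horizontality condition on the set holds trivially, both sides being
  0.\<close>
qed (use no_horizontal_extension in auto)

end
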